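(* Let $\langle X,\mu\rangle$ be a measure space with $\mu(X)<\infty$, let $M\in\mathbb{R}$, $M>0$, and let $I=(0,M)$ with the usual metric. For a measurable function $g:X\to\mathbb{R}$ with $0\le g<M$ define $s_g:[I]^{<\infty}\to\mathbb{R}$ as follows: for $H=\{a_1,\dots,a_n\}\in[I]^{<\infty}$ with $a_1<\dots<a_n$, put $a_0=0$, $a_{n+1}=M$ and \[s_g(H)=\sum_{i=0}^{n}a_i\,\mu\big(g^{-1}([a_i,a_{i+1}))\big).\] (a) If $f:X\to\mathbb{R}$ is measurable and $0\le f<M$, then $\mathrm{ext}(s_f,I)$ exists and equals $\int_X f\,d\mu$. (b) If $f:X\to\mathbb{R}$ is measurable with $|f|<M$ (so $f$ may take both positive and negative values), then $\mathrm{ext}(s_{|f|^+},I)-\mathrm{ext}(s_{|f|^-},I)=\int_X f\,d\mu$, where $|f|^+=\max\{0,f\}$ and $|f|^-=-\min\{0,f\}$.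
   Context: For a set $I$, $[I]^{<\infty}$ is the set of all finite subsets of $I$. For a pseudo-metric space $(I,d)$, $A\subset I$ and $\epsilon>0$, let $S(A,\epsilon)=\bigcup_{x\in A}\{y\in I: d(x,y)<\epsilon\}$. The Hausdorff pseudo-metric on subsets of $I$ is $d_H(A,C)=\inf\{\epsilon>0: A\subset S(C,\epsilon),\ C\subset S(A,\epsilon)\}$ (with $\inf\emptyset=+\infty$). $I$ is totally bounded if for every $\delta>0$ there is a finite $K\subset I$ with $S(K,\delta)=I$. Let $(I,d)$ be a totally bounded pseudo-metric space, $s:[I]^{<\infty}\to\mathbb{R}$ and $A\in\mathbb{R}$. We write $\mathrm{ext}(s,I)=A$ (and say that $\mathrm{ext}(s,I)$ exists) if for every $\epsilon>0$ there is $\delta>0$ such that $K\in[I]^{<\infty}$ and $d_H(K,I)<\delta$ imply $|s(K)-A|<\epsilon$. *)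

theory Defs
  imports "HOL-Analysis.Analysis"
begin

definition pseudo_metric_on :: "'a set \<Rightarrow> ('a \<Rightarrow> 'a \<Rightarrow> real) \<Rightarrow> bool" where
  "pseudo_metric_on I d \<longleftrightarrow>
     (\<forall>x\<in>I. d x x = 0) \<and>
     (\<forall>x\<in>I. \<forall>y\<in>I. 0 \<le> d x y \<and> d x y = d y x) \<and>
     (\<forall>x\<in>I. \<forall>y\<in>I. \<forall>z\<in>I. d x z \<le> d x y + d y z)"

definition enlargement :: "'a set \<Rightarrow> ('a \<Rightarrow> 'a \<Rightarrow> real) \<Rightarrow> 'a set \<Rightarrow> real \<Rightarrow> 'a set" where
  "enlargement I d A \<epsilon> = (\<Union>x\<in>A. {y\<in>I. d x y < \<epsilon>})"

text \<open>The infimum is taken in the extended reals, so that it is \<open>\<infinity>\<close> over the empty set.\<close>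

definition hausdorff_dist ::
  "'a set \<Rightarrow> ('a \<Rightarrow> 'a \<Rightarrow> real) \<Rightarrow> 'a set \<Rightarrow> 'a set \<Rightarrow> ereal" where
  "hausdorff_dist I d A C =
     (INF \<epsilon>\<in>{\<epsilon>::real. 0 < \<epsilon> \<and> A \<subseteq> enlargement I d C \<epsilon> \<and> C \<subseteq> enlargement I d A \<epsilon>}. ereal \<epsilon>)"

definition totally_bounded_on :: "'a set \<Rightarrow> ('a \<Rightarrow> 'a \<Rightarrow> real) \<Rightarrow> bool" where
  "totally_bounded_on I d \<longleftrightarrow> (\<forall>\<delta>>0. \<exists>K\<in>Fpow I. enlargement I d K \<delta> = I)"

text \<open>The relation ``\<open>ext(s, I) = A\<close>''. The standing assumption that \<open>(I, d)\<close> is a totally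
  bounded pseudo-metric space is part of the definition; without total boundedness the limit
  condition may hold vacuously for every \<open>A\<close>.\<close>

definition has_ext ::
  "('a set \<Rightarrow> real) \<Rightarrow> 'a set \<Rightarrow> ('a \<Rightarrow> 'a \<Rightarrow> real) \<Rightarrow> real \<Rightarrow> bool" where
  "has_ext s I d A \<longleftrightarrow>
     pseudo_metric_on I d \<and> totally_bounded_on I d \<and>
     (\<forall>\<epsilon>>0. \<exists>\<delta>>0. \<forall>K\<in>Fpow I. hausdorff_dist I d K I < ereal \<delta> \<longrightarrow> \<bar>s K - A\<bar> < \<epsilon>)"

definition ext_exists :: "('a set \<Rightarrow> real) \<Rightarrow> 'a set \<Rightarrow> ('a \<Rightarrow> 'a \<Rightarrow> real) \<Rightarrow> bool" where
  "ext_exists s I d \<longleftrightarrow> (\<exists>A. has_ext s I d A)"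

definition ext :: "('a set \<Rightarrow> real) \<Rightarrow> 'a set \<Rightarrow> ('a \<Rightarrow> 'a \<Rightarrow> real) \<Rightarrow> real" where
  "ext s I d = (THE A. has_ext s I d A)"

lemma totally_bounded_on_hausdorff_dist:
  assumes "pseudo_metric_on I d" "totally_bounded_on I d" "0 < (\<delta>::real)"
  obtains K where "K \<in> Fpow I" "hausdorff_dist I d K I < ereal \<delta>"
proof -
  have "0 < \<delta> / 2"
    using assms(3) by simp
  then obtain K where K: "K \<in> Fpow I" "enlargement I d K (\<delta> / 2) = I"
    using assms(2) unfolding totally_bounded_on_def by metis
  have "K \<subseteq> I"
    using K(1) by (simp add: Fpow_def)
  have "K \<subseteq> enlargement I d I (\<delta> / 2)"
  proof
    fix x assume "x \<in> K"
    then have x: "x \<in> I"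
      using \<open>K \<subseteq> I\<close> by blast
    then have "d x x = 0"
      using assms(1) by (simp add: pseudo_metric_on_def)
    then show "x \<in> enlargement I d I (\<delta> / 2)"
      unfolding enlargement_def using x \<open>0 < \<delta> / 2\<close> by (intro UN_I[OF x]) simp
  qed
  then have "hausdorff_dist I d K I \<le> ereal (\<delta> / 2)"
    unfolding hausdorff_dist_def using K(2) \<open>0 < \<delta> / 2\<close> by (intro INF_lower) auto
  also have "\<dots> < ereal \<delta>"
    using assms(3) by simp
  finally show ?thesis
    using that K(1) by blast
qed

lemma has_ext_unique:
  assumes "has_ext s I d A" "has_ext s I d B"
  shows "A = B"
proof (rule ccontr)
  assume "A \<noteq> B"
  then have e: "0 < \<bar>A - B\<bar> / 2"
    by simp
  obtain \<delta>1 where 1: "0 < \<delta>1"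
    "\<And>K. K \<in> Fpow I \<Longrightarrow> hausdorff_dist I d K I < ereal \<delta>1 \<Longrightarrow> \<bar>s K - A\<bar> < \<bar>A - B\<bar> / 2"
    using assms(1) e unfolding has_ext_def by blast
  obtain \<delta>2 where 2: "0 < \<delta>2"
    "\<And>K. K \<in> Fpow I \<Longrightarrow> hausdorff_dist I d K I < ereal \<delta>2 \<Longrightarrow> \<bar>s K - B\<bar> < \<bar>A - B\<bar> / 2"
    using assms(2) e unfolding has_ext_def by blast
  have "0 < min \<delta>1 \<delta>2"
    using 1(1) 2(1) by simp
  moreover have "pseudo_metric_on I d" "totally_bounded_on I d"
    using assms(1) by (auto simp: has_ext_def)
  ultimately obtain K where K: "K \<in> Fpow I" "hausdorff_dist I d K I < ereal (min \<delta>1 \<delta>2)"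
    using totally_bounded_on_hausdorff_dist by blast
  have "hausdorff_dist I d K I < ereal \<delta>1" "hausdorff_dist I d K I < ereal \<delta>2"
    using less_le_trans[OF K(2)] by simp_all
  then have "\<bar>s K - A\<bar> < \<bar>A - B\<bar> / 2" "\<bar>s K - B\<bar> < \<bar>A - B\<bar> / 2"
    using 1(2) 2(2) K(1) by auto
  then show False
    using abs_triangle_ineq4[of "s K - B" "s K - A"] by simp
qed

lemma ext_eqI: "has_ext s I d A \<Longrightarrow> ext s I d = A"
  unfolding ext_def using has_ext_unique by blast

text \<open>The list \<open>xs\<close> is \<open>a\<^sub>0 = 0, a\<^sub>1 < \<dots> < a\<^sub>n, a\<^sub>n\<^sub>+\<^sub>1 = M\<close>, where \<open>H = {a\<^sub>1, \<dots>, a\<^sub>n}\<close>.\<close>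

definition level_sum :: "'x measure \<Rightarrow> real \<Rightarrow> ('x \<Rightarrow> real) \<Rightarrow> real set \<Rightarrow> real" where
  "level_sum \<mu> M g H =
     (let xs = 0 # sorted_list_of_set H @ [M]
      in \<Sum>i=0..card H. xs ! i * measure \<mu> (g -` {xs ! i ..< xs ! (i + 1)} \<inter> space \<mu>))"

end

theory Submission
  imports Defs
begin

text \<open>If every point of \<open>(0, M)\<close> is within \<open>\<delta>\<close> of \<open>H\<close>, then consecutive points of
  \<open>0, a\<^sub>1, \<dots>, a\<^sub>n, M\<close> are at most \<open>2\<delta>\<close> apart, since otherwise the midpoint of a gap would be
  far from \<open>H\<close>. The level sum is the integral of the step function that rounds \<open>f\<close> down to the
  nearest point of the list, so it differs from \<open>\<integral>f\<close> by at most \<open>2\<delta>\<mu>(X)\<close>. Part (b) is part (a)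
  for the positive and negative parts of \<open>f\<close>.\<close>

lemma pseudo_metric_on_dist: "pseudo_metric_on I dist"
  by (auto simp: pseudo_metric_on_def dist_commute dist_triangle)

text \<open>Needed because \<open>(0, M)\<close> is totally bounded without being compact: it
  inherits the property from \<open>[0, M]\<close>. The centres of the finite net must lie in
  \<open>I\<close> itself, which \<open>Met_TC.mtotally_bounded_subset\<close> takes care
  of.\<close>

lemma totally_bounded_on_subset_compact:
  fixes I C :: "'a::metric_space set"
  assumes "compact C" "I \<subseteq> C"
  shows "totally_bounded_on I dist"
proof -
  have "Met_TC.mtotally_bounded C"
    using assms(1) by (simp add: Met_TC.compactin_imp_mtotally_bounded)
  then have tb: "Met_TC.mtotally_bounded I"
    using assms(2) Met_TC.mtotally_bounded_subset by blast
  show ?thesis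
    unfolding totally_bounded_on_def
  proof (intro allI impI)
    fix \<delta> :: real assume "0 < \<delta>"
    then obtain K where "finite K" "K \<subseteq> I" "I \<subseteq> (\<Union>x\<in>K. ball x \<delta>)"
      using tb unfolding Met_TC.mtotally_bounded_def by auto
    then show "\<exists>K\<in>Fpow I. enlargement I dist K \<delta> = I"
      by (intro bexI[of _ K]) (auto simp: Fpow_def enlargement_def subset_iff)
  qed
qed

lemma hausdorff_dist_lessE:
  assumes "hausdorff_dist I d A C < ereal \<delta>" "y \<in> C"
  obtains x where "x \<in> A" "d x y < \<delta>"
proof -
  from assms(1) obtain \<epsilon> where "\<epsilon> < \<delta>" "C \<subseteq> enlargement I d A \<epsilon>"
    unfolding hausdorff_dist_def INF_less_iff by auto
  with assms(2) that show ?thesis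
    unfolding enlargement_def by fastforce
qed

lemma sorted_wrt_less_gap:
  fixes xs :: "real list"
  assumes xs: "sorted_wrt (<) xs" and i: "Suc i < length xs"
    and near: "\<And>y. xs ! i < y \<Longrightarrow> y < xs ! Suc i \<Longrightarrow> \<exists>x\<in>set xs. dist x y < \<delta>"
  shows "xs ! Suc i - xs ! i \<le> 2 * \<delta>"
proof (rule ccontr)
  assume big: "\<not> xs ! Suc i - xs ! i \<le> 2 * \<delta>"
  define m where "m = (xs ! i + xs ! Suc i) / 2"
  have "xs ! i < xs ! Suc i"
    using xs i by (simp add: sorted_wrt_nth_less)
  then obtain x where x: "x \<in> set xs" "dist x m < \<delta>"
    using near[of m] by (auto simp: m_def)
  \<comment> \<open>Half of the gap exceeds \<open>\<delta>\<close>, so a point within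
    \<open>\<delta>\<close> of the midpoint cannot reach either end of the gap.\<close>
  have between: "xs ! i < x" "x < xs ! Suc i"
    using x(2) big by (auto simp: m_def dist_real_def abs_less_iff field_simps)
  obtain j where j: "j < length xs" "x = xs ! j"
    using x(1) by (auto simp: in_set_conv_nth)
  have "sorted xs"
    using xs by (rule strict_sorted_imp_sorted)
  \<comment> \<open>Whatever its index \<open>j\<close>, an entry of a sorted list cannot lie
    strictly between two neighbours.\<close>
  then have "x \<le> xs ! i \<or> xs ! Suc i \<le> x"
    using j i by (cases "j \<le> i") (auto intro: sorted_nth_mono)
  with between show False
    by auto
qed

text \<open>The index is the largest \<open>i \<le> n\<close> with \<open>xs ! i \<le> y\<close>.
  Repeated entries do no harm, since they only produce empty intervals.\<close>

lemma sorted_ex1_level: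
  fixes xs :: "'a::linorder list"
  assumes xs: "sorted xs" "length xs = n + 2" and y: "xs ! 0 \<le> y" "y < xs ! Suc n"
  shows "\<exists>!i. i \<le> n \<and> xs ! i \<le> y \<and> y < xs ! Suc i"
proof (rule ex_ex1I)
  define A where "A = {i. i \<le> n \<and> xs ! i \<le> y}"
  have A: "finite A" "A \<noteq> {}"
    using y by (auto simp: A_def)
  have "Max A \<in> A"
    using A by (rule Max_in)
  moreover have "y < xs ! Suc (Max A)"
  proof (rule ccontr)
    assume *: "\<not> y < xs ! Suc (Max A)"
    \<comment> \<open>If \<open>Max A = n\<close>, the negated claim contradicts the upper bound on
      \<open>y\<close>; otherwise the next index is still at most \<open>n\<close> and belongs to
      \<open>A\<close>.\<close>
    with y \<open>Max A \<in> A\<close> have "Suc (Max A) \<in> A"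
      by (cases "Max A = n") (auto simp: A_def)
    then show False
      using Max_ge[OF A(1)] by fastforce
  qed
  ultimately show "\<exists>i. i \<le> n \<and> xs ! i \<le> y \<and> y < xs ! Suc i"
    by (auto simp: A_def)
next
  fix i j
  assume ij: "i \<le> n \<and> xs ! i \<le> y \<and> y < xs ! Suc i" "j \<le> n \<and> xs ! j \<le> y \<and> y < xs ! Suc j"
  \<comment> \<open>From \<open>Suc a \<le> b\<close>, sortedness gives
    \<open>xs ! Suc a \<le> xs ! b \<le> y\<close>, against \<open>y < xs ! Suc a\<close>.\<close>
  have False if "a < b" "b \<le> n" "xs ! b \<le> y" "y < xs ! Suc a" for a b
    using sorted_nth_mono[OF xs(1), of "Suc a" b] that xs(2) by auto
  then show "i = j"
    using ij by (metis linorder_neqE_nat)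
qed

lemma (in finite_measure) step_sum_approximates_integral:
  fixes f :: "'a \<Rightarrow> real" and xs :: "real list"
  assumes f: "f \<in> borel_measurable M" and int: "integrable M f"
    and xs: "sorted xs" "length xs = n + 2"
    and range: "\<And>x. x \<in> space M \<Longrightarrow> xs ! 0 \<le> f x \<and> f x < xs ! Suc n"
    and gap: "\<And>i. i \<le> n \<Longrightarrow> xs ! Suc i - xs ! i \<le> \<eta>"
  shows "\<bar>(\<Sum>i=0..n. xs ! i * measure M (f -` {xs ! i ..< xs ! Suc i} \<inter> space M))
           - integral\<^sup>L M f\<bar> \<le> \<eta> * measure M (space M)"
proof -
  define B where "B i = f -` {xs ! i ..< xs ! Suc i} \<inter> space M" for i
  \<comment> \<open>The sets \<open>B i\<close> partition the space, so \<open>\<phi>\<close> is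
    \<open>f\<close> rounded down to an entry of \<open>xs\<close>, and its integral is the sum in
    question.\<close>
  define \<phi> where "\<phi> x = (\<Sum>i=0..n. xs ! i * indicator (B i) x)" for x
  have B: "B i \<in> sets M" for i
    unfolding B_def using f by measurable
  have int_B: "integrable M (indicat_real (B i))" for i
    by (intro integrable_real_indicator B) (simp add: emeasure_eq_measure)
  have int_\<phi>: "integrable M \<phi>"
    unfolding \<phi>_def by (intro Bochner_Integration.integrable_sum integrable_mult_right int_B)
  have "integral\<^sup>L M \<phi> = (\<Sum>i=0..n. xs ! i * measure M (B i))"
    unfolding \<phi>_def using B int_B
    by (subst Bochner_Integration.integral_sum) auto
  then have "\<bar>(\<Sum>i=0..n. xs ! i * measure M (B i)) - integral\<^sup>L M f\<bar> = \<bar>\<integral>x. \<phi> x - f x \<partial>M\<bar>"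
    using int int_\<phi> by simp
  also have "\<dots> \<le> (\<integral>x. \<bar>\<phi> x - f x\<bar> \<partial>M)"
    by (rule integral_abs_bound)
  also have "\<dots> \<le> (\<integral>x. \<eta> \<partial>M)"
  proof (rule integral_mono)
    fix x assume x: "x \<in> space M"
    have "\<exists>!i. i \<le> n \<and> xs ! i \<le> f x \<and> f x < xs ! Suc i"
      using range[OF x] by (intro sorted_ex1_level[OF xs]) auto
    then obtain i where i: "i \<le> n \<and> xs ! i \<le> f x \<and> f x < xs ! Suc i"
      and uniq: "\<forall>j. j \<le> n \<and> xs ! j \<le> f x \<and> f x < xs ! Suc j \<longrightarrow> j = i"
      by (rule ex1E)
    \<comment> \<open>Only the indicator of \<open>B i\<close> survives at \<open>x\<close>, so
      \<open>\<phi> x = xs ! i\<close>; since \<open>f x\<close> lies in an interval of length at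
      most \<open>\<eta>\<close> starting there, the pointwise error is at most
      \<open>\<eta>\<close>.\<close>
    have "x \<in> B j \<longleftrightarrow> j = i" if "j \<le> n" for j
      using x i uniq[rule_format, of j] that by (auto simp: B_def)
    then have "\<phi> x = (\<Sum>j=0..n. if j = i then xs ! i else 0)"
      unfolding \<phi>_def by (intro sum.cong refl) (simp add: indicator_def)
    also have "\<dots> = xs ! i"
      using i by simp
    finally show "\<bar>\<phi> x - f x\<bar> \<le> \<eta>"
      using i gap[of i] by simp
  qed (use int int_\<phi> in auto)
  also have "\<dots> = \<eta> * measure M (space M)"
    by simp
  finally show ?thesis
    by (simp add: B_def)
qed

lemma level_sum_has_ext:
  fixes f :: "'x \<Rightarrow> real"
  assumes "finite_measure \<mu>" and f: "f \<in> borel_measurable \<mu>"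
    and range: "\<And>x. x \<in> space \<mu> \<Longrightarrow> 0 \<le> f x \<and> f x < M"
  shows "has_ext (level_sum \<mu> M f) {0<..<M} dist (integral\<^sup>L \<mu> f)"
  unfolding has_ext_def
proof (intro conjI allI impI)
  interpret finite_measure \<mu> by fact
  have int: "integrable \<mu> f"
    using range f by (intro integrable_const_bound[where B = M]) (auto intro!: AE_I2 less_imp_le)
  show "totally_bounded_on {0<..<M} dist"
    by (rule totally_bounded_on_subset_compact[of "{0..M}"]) auto
  fix \<epsilon> :: real assume "0 < \<epsilon>"
  \<comment> \<open>The 2 absorbs the factor in the gap bound \<open>2 * \<delta>\<close>, and the
    \<open>+ 1\<close> keeps the denominator positive on a null space and makes the final inequality
    strict.\<close>
  define \<delta> where "\<delta> = \<epsilon> / (2 * (measure \<mu> (space \<mu>) + 1))"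
  have "0 < 2 * (measure \<mu> (space \<mu>) + 1)"
    by (simp add: add_nonneg_pos)
  then have \<delta>: "0 < \<delta>" "2 * \<delta> * measure \<mu> (space \<mu>) < \<epsilon>"
    using \<open>0 < \<epsilon>\<close> by (auto simp: \<delta>_def field_simps)
  show "\<exists>\<delta>>0. \<forall>K\<in>Fpow {0<..<M}. hausdorff_dist {0<..<M} dist K {0<..<M} < ereal \<delta> \<longrightarrow>
          \<bar>level_sum \<mu> M f K - integral\<^sup>L \<mu> f\<bar> < \<epsilon>"
  proof (intro exI[of _ \<delta>] conjI ballI impI)
    fix K assume "K \<in> Fpow {0<..<M}"
      and close: "hausdorff_dist {0<..<M} dist K {0<..<M} < ereal \<delta>"
    then have K: "finite K" "K \<subseteq> {0<..<M}"
      by (auto simp: Fpow_def)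
    define xs where "xs = 0 # sorted_list_of_set K @ [M]"
    have len: "length xs = card K + 2" and ends: "xs ! 0 = 0" "xs ! Suc (card K) = M"
      by (auto simp: xs_def nth_append)
    have "\<bar>(\<Sum>i=0..card K. xs ! i * measure \<mu> (f -` {xs ! i ..< xs ! Suc i} \<inter> space \<mu>))
             - integral\<^sup>L \<mu> f\<bar> \<le> 2 * \<delta> * measure \<mu> (space \<mu>)"
    \<comment> \<open>On an empty space all measures and the integral vanish. Otherwise a value of
      \<open>f\<close> forces \<open>0 < M\<close>, so that \<open>0\<close>, the points of
      \<open>K\<close> and \<open>M\<close> form a strictly increasing list.\<close>
    proof (cases "space \<mu> = {}")
      case True
      then have "f -` A \<inter> space \<mu> = {}" for A
        by blast
      then show ?thesis
        using True Bochner_Integration.integral_cong[of \<mu> \<mu> f "\<lambda>_. 0"] by simp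
    next
      case False
      then have "0 < M"
        using range by (metis all_not_in_conv le_less_trans)
      then have sorted: "sorted_wrt (<) xs"
        using K by (auto simp: xs_def sorted_wrt_append)
      have gap: "xs ! Suc i - xs ! i \<le> 2 * \<delta>" if i: "i \<le> card K" for i
      proof (rule sorted_wrt_less_gap[OF sorted])
        show "Suc i < length xs"
          using i len by simp
        fix y assume y: "xs ! i < y" "y < xs ! Suc i"
        \<comment> \<open>Hausdorff closeness only speaks of points of \<open>(0, M)\<close>, so
          \<open>y\<close> has to be placed there first; the ends of the list bound it.\<close>
        have "0 \<le> xs ! i" "xs ! Suc i \<le> M"
          using sorted_nth_mono[OF strict_sorted_imp_sorted[OF sorted], of 0 i]
            sorted_nth_mono[OF strict_sorted_imp_sorted[OF sorted], of "Suc i" "Suc (card K)"]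
            i len ends by auto
        with y have "y \<in> {0<..<M}"
          by auto
        then obtain x where "x \<in> K" "dist x y < \<delta>"
          using hausdorff_dist_lessE[OF close] by blast
        then show "\<exists>x\<in>set xs. dist x y < \<delta>"
          using K by (auto simp: xs_def)
      qed
      show ?thesis
        by (rule step_sum_approximates_integral[OF f int strict_sorted_imp_sorted[OF sorted] len])
           (use range ends gap in auto)
    qed
    with \<delta>(2) show "\<bar>level_sum \<mu> M f K - integral\<^sup>L \<mu> f\<bar> < \<epsilon>"
      by (simp add: level_sum_def Let_def flip: xs_def)
  qed (rule \<delta>(1))
qed (rule pseudo_metric_on_dist)

theorem theorem5p38:
  fixes \<mu> :: "'x measure" and M :: real
  assumes "finite_measure \<mu>" and "0 < M"
  shows "(\<forall>f. f \<in> borel_measurable \<mu> \<and> (\<forall>x\<in>space \<mu>. 0 \<le> f x \<and> f x < M) \<longrightarrow>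
            ext_exists (level_sum \<mu> M f) {0<..<M} dist \<and>
            ext (level_sum \<mu> M f) {0<..<M} dist = integral\<^sup>L \<mu> f) \<and>
         (\<forall>f. f \<in> borel_measurable \<mu> \<and> (\<forall>x\<in>space \<mu>. \<bar>f x\<bar> < M) \<longrightarrow>
            ext_exists (level_sum \<mu> M (\<lambda>x. max 0 (f x))) {0<..<M} dist \<and>
            ext_exists (level_sum \<mu> M (\<lambda>x. - min 0 (f x))) {0<..<M} dist \<and>
            ext (level_sum \<mu> M (\<lambda>x. max 0 (f x))) {0<..<M} dist
              - ext (level_sum \<mu> M (\<lambda>x. - min 0 (f x))) {0<..<M} dist = integral\<^sup>L \<mu> f)"
proof -
  interpret finite_measure \<mu> by fact
  have *: "ext_exists (level_sum \<mu> M g) {0<..<M} dist \<and>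
      ext (level_sum \<mu> M g) {0<..<M} dist = integral\<^sup>L \<mu> g"
    if "g \<in> borel_measurable \<mu>" "\<And>x. x \<in> space \<mu> \<Longrightarrow> 0 \<le> g x \<and> g x < M" for g
    using level_sum_has_ext[OF assms(1) that] ext_eqI unfolding ext_exists_def by blast
  show ?thesis
  proof (intro conjI[of "All _"] allI impI)
    fix f assume "f \<in> borel_measurable \<mu> \<and> (\<forall>x\<in>space \<mu>. \<bar>f x\<bar> < M)"
    then have f[measurable]: "f \<in> borel_measurable \<mu>" and bd: "\<And>x. x \<in> space \<mu> \<Longrightarrow> \<bar>f x\<bar> < M"
      by auto
    let ?p = "\<lambda>x. max 0 (f x)" and ?n = "\<lambda>x. - min 0 (f x)"
    \<comment> \<open>A bounded measurable function on a finite measure space is integrable. So are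
      then its positive and negative parts, whose integrals may be subtracted; pointwise,
      \<open>f\<close> is \<open>?p\<close> minus \<open>?n\<close>.\<close>
    have "integrable \<mu> f"
      using bd by (intro integrable_const_bound[where B = M]) (auto intro!: AE_I2 less_imp_le)
    then have "integrable \<mu> ?p" "integrable \<mu> ?n"
      by auto
    then have "integral\<^sup>L \<mu> ?p - integral\<^sup>L \<mu> ?n = (\<integral>x. ?p x - ?n x \<partial>\<mu>)"
      by (rule Bochner_Integration.integral_diff[symmetric])
    also have "\<dots> = integral\<^sup>L \<mu> f"
      by (intro Bochner_Integration.integral_cong) auto
    finally have "integral\<^sup>L \<mu> ?p - integral\<^sup>L \<mu> ?n = integral\<^sup>L \<mu> f" .
    moreover note *[of ?p] *[of ?n]
    moreover have "0 \<le> ?p x \<and> ?p x < M" "0 \<le> ?n x \<and> ?n x < M" if "x \<in> space \<mu>" for x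
      using bd[OF that] assms(2) by auto
    ultimately show "ext_exists (level_sum \<mu> M ?p) {0<..<M} dist \<and>
        ext_exists (level_sum \<mu> M ?n) {0<..<M} dist \<and>
        ext (level_sum \<mu> M ?p) {0<..<M} dist - ext (level_sum \<mu> M ?n) {0<..<M} dist
          = integral\<^sup>L \<mu> f"
      by simp
  qed (use * in blast)
qed

end
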